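(* Let $X$ be a Banach space and let $\{\varphi_t : X\to X \mid t\ge 0\}$ be a semigroup of continuous linear operators (not assumed bounded) such that for each $v\in X$ the function $t\mapsto \varphi_t(v)$ is continuous for $t>0$. Let $X_0=\{x\in X\mid \varphi_t(x)\to 0 \text{ as } t\to\infty\}$ and suppose that $\operatorname{codim} X_0=1$. Let $Y\subset X$ be a one-dimensional subspace such that $X_0\oplus Y=X$, and write $Y_t=\varphi_t(Y)$. Then $Y$ is almost stabilizable; i.e., for each $t<\infty$, $$\sup_{0\le s<t}\angle(Y_T,Y_{T+s})\to 0\quad\text{as } T\to\infty .$$
   Context: A semigroup means $\varphi_t\circ\varphi_q=\varphi_{t+q}$ for all $t,q\ge 0$. For subspaces $A,B\subset X$ the angle is $$\angle(A,B)=\min\Bigl\{\sup_{a\in A,\,|a|=1}\rho(a,B),\ \sup_{b\in B,\,|b|=1}\rho(b,A)\Bigr\},$$ where $\rho(v,A)$ denotes the distance from the vector $v$ to the subspace $A$. *)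

theory Defs
  imports "HOL-Analysis.Analysis"
begin

text \<open>
  A Banach space over the reals or the complex numbers. The library has only real Banach spaces, so
  the scalar multiplication is a parameter compatible with the underlying real structure.
  A real normed field satisfying Heine-Borel is finite-dimensional over the reals,
  hence isometrically isomorphic to the reals or the complex numbers. The real case is
  \<open>sm = (*\<^sub>R)\<close>.
\<close>

locale banach_space_over = vector_space sm
  for sm :: "'k :: {real_normed_field, heine_borel} \<Rightarrow> 'a :: banach \<Rightarrow> 'a" +
  assumes sm_of_real: "sm (of_real r) x = r *\<^sub>R x"
    and norm_sm: "norm (sm c x) = norm c * norm x"

text \<open>
  The operators are individually continuous, but their norms need not be bounded uniformly in \<open>t\<close>.
  Neither \<open>\<phi> 0 = id\<close> nor strong continuity at \<open>t = 0\<close> is required.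
\<close>

definition operator_semigroup ::
  "('k::field \<Rightarrow> 'a \<Rightarrow> 'a::real_normed_vector) \<Rightarrow> (real \<Rightarrow> 'a \<Rightarrow> 'a) \<Rightarrow> bool" where
  "operator_semigroup sm \<phi> \<longleftrightarrow>
     (\<forall>t\<ge>0. \<forall>q\<ge>0. \<phi> t \<circ> \<phi> q = \<phi> (t + q)) \<and>
     (\<forall>t\<ge>0. Vector_Spaces.linear sm sm (\<phi> t)) \<and>
     (\<forall>t\<ge>0. continuous_on UNIV (\<phi> t))"

definition null_orbits :: "(real \<Rightarrow> 'a \<Rightarrow> 'a::real_normed_vector) \<Rightarrow> 'a set" where
  "null_orbits \<phi> = {x. ((\<lambda>t. \<phi> t x) \<longlongrightarrow> 0) at_top}"

text \<open>
  A subspace \<open>A\<close> has codimension \<open>n\<close> if the quotient by \<open>A\<close> has dimension \<open>n\<close>, i.e. there are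
  \<open>n\<close> vectors whose cosets form a basis of the quotient: every coset is a linear combination of
  theirs with unique coefficients (which are normalised to be \<open>0\<close> outside \<open>B\<close>).
\<close>

definition has_codim :: "('k::field \<Rightarrow> 'a \<Rightarrow> 'a::ab_group_add) \<Rightarrow> 'a set \<Rightarrow> nat \<Rightarrow> bool" where
  "has_codim sm A n \<longleftrightarrow>
     module.subspace sm A \<and>
     (\<exists>B. finite B \<and> card B = n \<and>
        (\<forall>x. \<exists>!c. (\<forall>b. b \<notin> B \<longrightarrow> c b = 0) \<and> x - (\<Sum>b\<in>B. sm (c b) b) \<in> A))"

definition direct_sum_UNIV :: "'a::ab_group_add set \<Rightarrow> 'a set \<Rightarrow> bool" where
  "direct_sum_UNIV A B \<longleftrightarrow> A \<inter> B = {0} \<and> {a + b | a b. a \<in> A \<and> b \<in> B} = UNIV"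

text \<open>
  For nonzero subspaces both suprema are over nonempty sets of reals contained in \<open>{0..1}\<close>. For the
  zero subspace one of them is a supremum of the empty set, an unspecified real.
\<close>

definition subspace_angle :: "'a::real_normed_vector set \<Rightarrow> 'a set \<Rightarrow> real" where
  "subspace_angle A B =
     min (SUP a\<in>{a\<in>A. norm a = 1}. infdist a B) (SUP b\<in>{b\<in>B. norm b = 1}. infdist b A)"

text \<open>Only \<open>t > 0\<close> is considered, since otherwise there is no \<open>s\<close> with \<open>0 \<le> s < t\<close>.\<close>

definition almost_stabilizable ::
  "(real \<Rightarrow> 'a \<Rightarrow> 'a::real_normed_vector) \<Rightarrow> 'a set \<Rightarrow> bool" where
  "almost_stabilizable \<phi> Y \<longleftrightarrow>
     (\<forall>t>0. ((\<lambda>T. SUP s\<in>{0..<t}. subspace_angle (\<phi> T ` Y) (\<phi> (T + s) ` Y)) \<longlongrightarrow> 0) at_top)"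

end

theory Submission
  imports Defs
begin

text \<open>
  Let \<open>y\<close> span \<open>Y\<close> and split \<open>\<phi> s y = x s + \<lambda> s y\<close> with \<open>x s\<close> in the hyperplane of null orbits. The
  semigroup law turns this into \<open>\<phi> (T + s) y = \<phi> T (x s) + \<lambda> s \<phi> T y\<close>, so the angle between the two
  lines is at most \<open>norm (\<phi> T (x s)) / norm (\<phi> T y)\<close> as soon as \<open>\<lambda> s\<close> has modulus at least \<open>1\<close>. It
  remains to bound \<open>\<phi> T y\<close> away from \<open>0\<close> and to show that \<open>\<phi> T (x s)\<close> tends to \<open>0\<close> uniformly for
  \<open>s\<close> in a bounded interval.

  The key is \<open>null_part_bounds\<close>: although the hyperplane is not assumed to be closed, it is complete
  for the norm that adds the supremum of an orbit over times at least \<open>1\<close>. Together with the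
  complementary line it then exhausts the Banach space, and an open mapping argument, in the form of
  Zabreiko's lemma on countably subadditive seminorms, makes the projection onto the hyperplane
  continuous and the operators \<open>\<phi> t\<close>, for \<open>t \<ge> 1\<close>, equibounded on it.

  Modulus at least \<open>1\<close> holds because a factor \<open>\<lambda> s\<close> of modulus less than \<open>1\<close> would contract the orbit
  of \<open>y\<close> to \<open>0\<close> (\<open>coord_orbit_ge_1\<close>); with the continuity of the coordinate this also bounds \<open>\<phi> T y\<close>
  from below. Uniformity in \<open>s\<close> follows from compactness of \<open>{\<phi> 1 (x s) | 0 \<le> s \<le> t}\<close> and
  equiboundedness (\<open>orbit_drift_uniform\<close>).
\<close>

section \<open>Countably subadditive seminorms\<close>

text \<open>
  Zabreiko's lemma. By Baire's theorem the closure of some set \<open>{x. p x \<le> n}\<close> contains a ball, and by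
  symmetry and convexity one around \<open>0\<close>. Hence every vector can be approximated, up to half its norm,
  by a vector whose \<open>p\<close> is controlled by that norm. Repeating this with the remainders writes \<open>x\<close>
  as a series on which countable subadditivity gives the bound.
\<close>

lemma countably_subadditive_seminorm_bounded:
  fixes p :: "'a::banach \<Rightarrow> real"
  assumes nonneg: "\<And>x. 0 \<le> p x"
    and homog: "\<And>r x. p (r *\<^sub>R x) = \<bar>r\<bar> * p x"
    and subadd: "\<And>z. summable z \<Longrightarrow> summable (\<lambda>n. p (z n)) \<Longrightarrow> p (suminf z) \<le> (\<Sum>n. p (z n))"
  shows "\<exists>C>0. \<forall>x. p x \<le> C * norm x"
proof -
  have p0: "p 0 = 0"
    using homog[of 0 0] by simp
  have p_add: "p (a + b) \<le> p a + p b" for a b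
  proof -
    define z where "z n = (if n = 0 then a else if n = 1 then b else 0)" for n :: nat
    have "z sums (\<Sum>n\<in>{0,1}. z n)"
      by (rule sums_finite) (auto simp: z_def)
    then have z: "z sums (a + b)" by (simp add: z_def)
    have "(\<lambda>n. p (z n)) sums (\<Sum>n\<in>{0,1}. p (z n))"
      by (rule sums_finite) (auto simp: z_def p0)
    then have pz: "(\<lambda>n. p (z n)) sums (p a + p b)" by (simp add: z_def)
    show ?thesis
      using subadd[of z] z pz by (auto simp: sums_iff)
  qed
  have p_diff: "p (a - b) \<le> p a + p b" for a b
    using p_add[of a "- b"] homog[of "-1" b] by simp
  define A where "A n = closure {x. p x \<le> real n}" for n :: nat
  have cover: "\<Union>(range A) = UNIV"
  proof -
    have "x \<in> A (nat \<lceil>p x\<rceil>)" for x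
      unfolding A_def by (rule subsetD[OF closure_subset]) (simp add: real_nat_ceiling_ge)
    then show ?thesis by blast
  qed
  have "\<exists>n. interior (A n) \<noteq> {}"
  proof (rule ccontr)
    assume "\<not> ?thesis"
    then have "(euclidean::'a topology) interior_of \<Union>(range A) = {}"
      by (intro Baire_category_alt)
         (auto simp: A_def completely_metrizable_space_euclidean)
    then show False
      by (simp add: cover)
  qed
  then obtain n x0 r where r: "0 < r" and ball: "ball x0 r \<subseteq> A n"
    by (metis all_not_in_conv mem_interior)
  have near: "\<exists>a. p a \<le> real n \<and> norm (u - a) < d" if u: "norm u < r" and d: "0 < d" for u d
  proof -
    have "x0 + u \<in> A n" "x0 - u \<in> A n"
      using ball u by (auto simp: dist_norm)
    then obtain a b where a: "p a \<le> n" "dist a (x0 + u) < d" and b: "p b \<le> n" "dist b (x0 - u) < d"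
      unfolding A_def closure_approachable using d by blast
    have "p ((1/2) *\<^sub>R (a - b)) \<le> n"
      using homog[of "1/2" "a - b"] p_diff[of a b] a b by simp
    moreover have "u - (1/2) *\<^sub>R (a - b) = (1/2) *\<^sub>R ((x0 + u - a) - (x0 - u - b))"
      by (simp add: algebra_simps flip: scaleR_add_left)
    then have "norm (u - (1/2) *\<^sub>R (a - b)) \<le> (norm (x0 + u - a) + norm (x0 - u - b)) / 2"
      using norm_triangle_ineq4[of "x0 + u - a" "x0 - u - b"] by simp
    with a b have "norm (u - (1/2) *\<^sub>R (a - b)) < d"
      by (simp add: dist_norm norm_minus_commute)
    ultimately show ?thesis by blast
  qed
  define K where "K = 2 * real n / r"
  have K0: "0 \<le> K" using r by (simp add: K_def)
  have half: "\<exists>a. p a \<le> K * norm u \<and> norm (u - a) \<le> norm u / 2" for u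
  proof (cases "u = 0")
    case True
    then show ?thesis using p0 by (intro exI[of _ 0]) auto
  next
    case False
    define c where "c = 2 * norm u / r"
    have c: "0 < c" using False r by (simp add: c_def)
    have "norm ((1/c) *\<^sub>R u) < r"
      using False r by (simp add: c_def)
    then obtain a where a: "p a \<le> n" "norm ((1/c) *\<^sub>R u - a) < norm u / (2 * c)"
      using near[of "(1/c) *\<^sub>R u" "norm u / (2 * c)"] False c by auto
    have "p (c *\<^sub>R a) \<le> K * norm u"
      using a(1) c r mult_left_mono[of "p a" n c] by (simp add: homog c_def K_def mult_ac)
    moreover have "u - c *\<^sub>R a = c *\<^sub>R ((1/c) *\<^sub>R u - a)"
      using c by (simp add: algebra_simps)
    then have "norm (u - c *\<^sub>R a) = c * norm ((1/c) *\<^sub>R u - a)"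
      using c by simp
    then have "norm (u - c *\<^sub>R a) \<le> norm u / 2"
      using a(2) c mult_left_mono[of "norm ((1/c) *\<^sub>R u - a)" "norm u / (2 * c)" c] by simp
    ultimately show ?thesis by blast
  qed
  then obtain g where g: "\<And>u. p (g u) \<le> K * norm u" "\<And>u. norm (u - g u) \<le> norm u / 2"
    by metis
  have "p x \<le> (2 * K + 1) * norm x" for x
  proof -
    \<comment> \<open>The remainder after \<open>k\<close> successive approximations.\<close>
    define u where "u k = ((\<lambda>u. u - g u) ^^ k) x" for k
    have u_Suc: "u (Suc k) = u k - g (u k)" for k by (simp add: u_def)
    have norm_u: "norm (u k) \<le> norm x * (1/2) ^ k" for k
    proof (induction k)
      case 0 then show ?case by (simp add: u_def)
    next
      case (Suc k)
      have "norm (u (Suc k)) \<le> norm (u k) / 2" using g(2) by (simp add: u_Suc)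
      then show ?case using Suc by simp
    qed
    have "(\<lambda>k. norm x * (1/2) ^ k) \<longlonglongrightarrow> norm x * 0"
      by (intro tendsto_mult tendsto_const LIMSEQ_power_zero) simp
    then have "u \<longlonglongrightarrow> 0"
      using norm_u by (intro Lim_null_comparison[of u]) auto
    then have "(\<lambda>k. u k - u (Suc k)) sums (u 0 - 0)"
      by (rule telescope_sums')
    then have gs: "(\<lambda>k. g (u k)) sums x"
      by (simp add: u_Suc) (simp add: u_def)
    have geo: "(\<lambda>k. K * norm x * (1/2) ^ k) sums (K * norm x * 2)"
      using sums_mult[OF geometric_sums[of "1/2::real"], of "K * norm x"] by simp
    have le: "p (g (u k)) \<le> K * norm x * (1/2) ^ k" for k
      using g(1)[of "u k"] mult_left_mono[OF norm_u[of k] K0] by (simp add: mult.assoc)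
    have pg: "summable (\<lambda>k. p (g (u k)))"
      by (rule summable_comparison_test'[OF sums_summable[OF geo], of 0]) (use le nonneg in auto)
    have "p x \<le> (\<Sum>k. p (g (u k)))"
      using subadd[OF sums_summable[OF gs] pg] sums_unique[OF gs] by simp
    also have "\<dots> \<le> (\<Sum>k. K * norm x * (1/2) ^ k)"
      by (rule suminf_le[OF le pg sums_summable[OF geo]])
    also have "\<dots> = K * norm x * 2" using geo by (simp add: sums_iff)
    finally show ?thesis
      by (simp add: algebra_simps add_increasing)
  qed
  with K0 show ?thesis by (intro exI[of _ "2 * K + 1"]) auto
qed

section \<open>Approximate contractions of the half line\<close>

text \<open>
  Steps of length \<open>s\<close> contract \<open>f\<close> by the factor \<open>q\<close> up to a vanishing error, so the starting values
  on one interval of length \<open>s\<close>, which are bounded by continuity, are forgotten. The interval has to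
  start at a positive time, because \<open>f\<close> may be unbounded near \<open>0\<close>.
\<close>

lemma contraction_tendsto_zero:
  fixes f g :: "real \<Rightarrow> real"
  assumes cont: "continuous_on {0<..} f"
    and nonneg: "\<And>T. 0 \<le> f T"
    and s: "0 < s" and q: "0 \<le> q" "q < 1"
    and step: "\<And>T. 0 \<le> T \<Longrightarrow> f (T + s) \<le> g T + q * f T"
    and g: "(g \<longlongrightarrow> 0) at_top"
  shows "(f \<longlongrightarrow> 0) at_top"
proof (rule order_tendstoI)
  fix a :: real assume "a < 0"
  then show "\<forall>\<^sub>F T in at_top. a < f T"
    using nonneg by (intro always_eventually allI) (rule less_le_trans)
next
  fix e :: real assume e: "0 < e"
  have "\<forall>\<^sub>F T in at_top. g T < e / 2 * (1 - q)"
    using order_tendstoD(2)[OF g, of "e / 2 * (1 - q)"] e q by simp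
  then obtain T1 where T1: "\<And>T. T1 \<le> T \<Longrightarrow> g T < e / 2 * (1 - q)"
    unfolding eventually_at_top_linorder by blast
  define T0 where "T0 = max T1 1"
  have "compact (f ` {T0..T0 + s})"
    by (intro compact_continuous_image continuous_on_subset[OF cont]) (auto simp: T0_def)
  then obtain B where B: "\<And>T. T0 \<le> T \<Longrightarrow> T \<le> T0 + s \<Longrightarrow> f T \<le> B"
    using compact_imp_bounded[THEN bounded_imp_bdd_above] by (force simp: bdd_above_def)
  have iter: "f (T + real n * s) \<le> q ^ n * B + e / 2" if T: "T0 \<le> T" "T \<le> T0 + s" for T n
  proof (induction n)
    case 0 then show ?case using B[OF T] e by simp
  next
    case (Suc n)
    have ge: "T0 \<le> T + real n * s" using T s by (simp add: add_increasing2)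
    have "f (T + real (Suc n) * s) \<le> g (T + real n * s) + q * f (T + real n * s)"
      using step[of "T + real n * s"] ge by (simp add: T0_def algebra_simps)
    also have "\<dots> \<le> e / 2 * (1 - q) + q * (q ^ n * B + e / 2)"
      using T1[of "T + real n * s"] ge mult_left_mono[OF Suc q(1)] by (simp add: T0_def)
    also have "\<dots> = q ^ Suc n * B + e / 2" by (simp add: field_simps)
    finally show ?case .
  qed
  have "(\<lambda>n. q ^ n * B) \<longlonglongrightarrow> 0 * B"
    using q by (intro tendsto_mult tendsto_const LIMSEQ_power_zero) simp
  then have "\<forall>\<^sub>F n in sequentially. q ^ n * B < e / 2"
    using e by (intro order_tendstoD(2)) auto
  then obtain N where N: "\<And>n. N \<le> n \<Longrightarrow> q ^ n * B < e / 2"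
    unfolding eventually_sequentially by blast
  have "f T < e" if T: "T0 + real N * s \<le> T" for T
  proof -
    define n where "n = nat \<lfloor>(T - T0) / s\<rfloor>"
    have "real N \<le> (T - T0) / s" using T s by (simp add: field_simps)
    then have n: "real n \<le> (T - T0) / s" "(T - T0) / s \<le> real n + 1" "N \<le> n"
      unfolding n_def by linarith+
    then have "T0 \<le> T - real n * s" "T - real n * s \<le> T0 + s"
      using s by (simp_all add: field_simps)
    from iter[OF this, of n] N[OF n(3)] show ?thesis by simp
  qed
  then show "\<forall>\<^sub>F T in at_top. f T < e"
    unfolding eventually_at_top_linorder by blast
qed

section \<open>Lines in a Banach space and their angles\<close>

context banach_space_over
begin

lemma tendsto_scale_left:
  assumes "(k \<longlongrightarrow> c) F"
  shows "((\<lambda>x. sm (k x) v) \<longlongrightarrow> sm c v) F"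
proof -
  have "((\<lambda>x. norm (sm (k x) v - sm c v)) \<longlongrightarrow> 0) F"
    using tendsto_mult_right[OF tendsto_norm_zero[OF LIM_zero[OF assms]], of "norm v"]
    by (simp add: norm_sm flip: scale_left_diff_distrib)
  then show ?thesis
    by (rule LIM_zero_cancel[OF tendsto_norm_zero_cancel])
qed

text \<open>
  Lines are closed, because the scalar field is complete.
\<close>

lemma line_limit:
  assumes v0: "v \<noteq> 0" and lim: "(\<lambda>n. sm (k n) v) \<longlonglongrightarrow> w"
  obtains c where "w = sm c v"
proof -
  have "Cauchy (\<lambda>n. sm (k n) v)"
    by (rule LIMSEQ_imp_Cauchy[OF lim])
  then have "Cauchy k"
    unfolding Cauchy_altdef
  proof (intro allI impI)
    fix e :: real assume C: "\<forall>e>0. \<exists>M. \<forall>m\<ge>M. \<forall>n>m. dist (sm (k m) v) (sm (k n) v) < e" and e: "0 < e"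
    then obtain M where M: "\<And>m n. M \<le> m \<Longrightarrow> m < n \<Longrightarrow> dist (sm (k m) v) (sm (k n) v) < e * norm v"
      using v0 by (metis zero_less_mult_iff zero_less_norm_iff)
    have "dist (sm (k m) v) (sm (k n) v) = dist (k m) (k n) * norm v" for m n
      by (simp add: dist_norm norm_sm flip: scale_left_diff_distrib)
    with M v0 show "\<exists>M. \<forall>m\<ge>M. \<forall>n>m. dist (k m) (k n) < e"
      by (intro exI[of _ M]) simp
  qed
  then obtain c where c: "k \<longlonglongrightarrow> c"
    using Cauchy_convergent_iff convergent_def by blast
  from LIMSEQ_unique[OF lim tendsto_scale_left[OF c]] show thesis
    by (rule that)
qed

lemma norm_line_unit:
  assumes "v \<noteq> 0"
  shows "{a \<in> range (\<lambda>c. sm c v). norm a = 1} \<noteq> {}"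
proof -
  have "norm (sm (of_real (1 / norm v)) v) = 1"
    using assms by (simp add: norm_sm norm_divide)
  then show ?thesis by blast
qed

text \<open>
  Each distance is nonnegative, but a supremum of reals inherits this only from a nonempty set that
  is bounded above: a line has unit vectors, and none is farther than \<open>1\<close> from a subspace.
\<close>

lemma angle_lines_nonneg:
  assumes "v \<noteq> 0" "w \<noteq> 0"
  shows "0 \<le> subspace_angle (range (\<lambda>c. sm c v)) (range (\<lambda>c. sm c w))"
proof -
  have "0 \<le> (SUP a\<in>{a \<in> range (\<lambda>c. sm c v). norm a = 1}. infdist a (range (\<lambda>c. sm c w)))"
    if v: "v \<noteq> 0" for v w
  proof -
    obtain a where a: "a \<in> {a \<in> range (\<lambda>c. sm c v). norm a = 1}"
      using norm_line_unit[OF v] by blast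
    have "0 \<in> range (\<lambda>c. sm c w)"
      by (rule range_eqI[of _ _ 0]) simp
    then have le: "infdist b (range (\<lambda>c. sm c w)) \<le> norm b" for b
      using infdist_le[of 0 "range (\<lambda>c. sm c w)" b] by simp
    have "bdd_above ((\<lambda>a. infdist a (range (\<lambda>c. sm c w))) ` {a \<in> range (\<lambda>c. sm c v). norm a = 1})"
    proof (rule bdd_aboveI2)
      show "infdist b (range (\<lambda>c. sm c w)) \<le> 1" if "b \<in> {a \<in> range (\<lambda>c. sm c v). norm a = 1}" for b
        using le[of b] that by simp
    qed
    then show ?thesis
      by (rule cSUP_upper2[OF _ a infdist_nonneg])
  qed
  with assms show ?thesis
    unfolding subspace_angle_def by simp
qed

text \<open>
  The first of the two suprema already gives the bound: the vector \<open>sm (1 / c) w\<close> differs from \<open>v\<close> by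
  \<open>sm (1 / c) x\<close>, which is no longer than \<open>x\<close>.
\<close>

lemma angle_lines_le:
  assumes v: "v \<noteq> 0" and w: "w = x + sm c v" and c: "1 \<le> norm c"
  shows "subspace_angle (range (\<lambda>c. sm c v)) (range (\<lambda>c. sm c w)) \<le> norm x / norm v"
  unfolding subspace_angle_def
proof (rule min.coboundedI1, rule cSUP_least[OF norm_line_unit[OF v]])
  fix a assume "a \<in> {a \<in> range (\<lambda>c. sm c v). norm a = 1}"
  then obtain d where d: "a = sm d v" "norm d * norm v = 1"
    unfolding norm_sm[symmetric] by blast
  have "c \<noteq> 0" using c by auto
  have "infdist a (range (\<lambda>c. sm c w)) \<le> dist a (sm (d / c) w)"
    by (intro infdist_le rangeI)
  also have "\<dots> = norm (sm (d / c) x)"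
    using \<open>c \<noteq> 0\<close> by (simp add: dist_norm d w scale_right_distrib)
  also have "\<dots> = norm d / norm c * norm x"
    by (simp add: norm_sm norm_divide)
  also have "\<dots> \<le> norm d * norm x"
    using divide_left_mono[of 1 "norm c" "norm d"] c \<open>c \<noteq> 0\<close> by (intro mult_right_mono) auto
  also have "norm d = 1 / norm v"
    using d(2) v by (simp add: field_simps)
  finally show "infdist a (range (\<lambda>c. sm c w)) \<le> norm x / norm v" by simp
qed

end

section \<open>Boundedness of the projection onto the null orbits\<close>

text \<open>
  The setting after a vector \<open>y\<close> spanning the complementary line has been chosen.
\<close>

locale null_hyperplane_semigroup = banach_space_over sm
  for sm :: "'k :: {real_normed_field, heine_borel} \<Rightarrow> 'a :: banach \<Rightarrow> 'a" +
  fixes \<phi> :: "real \<Rightarrow> 'a \<Rightarrow> 'a" and y :: 'a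
  assumes semigroup: "operator_semigroup sm \<phi>"
    and orbit_continuous: "\<And>v. continuous_on {0<..} (\<lambda>t. \<phi> t v)"
    and subspace_null: "subspace (null_orbits \<phi>)"
    and y_not_null: "y \<notin> null_orbits \<phi>"
    and decomposition: "\<And>z. \<exists>k. z - sm k y \<in> null_orbits \<phi>"
begin

lemma phi_phi: "0 \<le> t \<Longrightarrow> 0 \<le> s \<Longrightarrow> \<phi> t (\<phi> s x) = \<phi> (t + s) x"
  using semigroup unfolding operator_semigroup_def by (metis comp_apply)

lemma phi_hom: "0 \<le> t \<Longrightarrow> module_hom sm sm (\<phi> t)"
  using semigroup unfolding operator_semigroup_def by (simp add: module_hom_iff_linear)

lemmas phi_add = module_hom.add[OF phi_hom]
  and phi_diff = module_hom.diff[OF phi_hom]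
  and phi_scale = module_hom.scale[OF phi_hom]
  and phi_zero = module_hom.zero[OF phi_hom]
  and phi_sum = module_hom.sum[OF phi_hom]

lemma phi_tendsto: "0 \<le> t \<Longrightarrow> (f \<longlongrightarrow> l) F \<Longrightarrow> ((\<lambda>n. \<phi> t (f n)) \<longlongrightarrow> \<phi> t l) F"
  using semigroup unfolding operator_semigroup_def
  by (intro continuous_on_tendsto_compose[of UNIV "\<phi> t"]) auto

lemma null_tendsto: "x \<in> null_orbits \<phi> \<Longrightarrow> ((\<lambda>t. \<phi> t x) \<longlongrightarrow> 0) at_top"
  by (simp add: null_orbits_def)

text \<open>
  The operator \<open>\<phi> s\<close> commutes with the semigroup and is continuous at \<open>0\<close>.
\<close>

lemma null_invariant: "0 \<le> s \<Longrightarrow> x \<in> null_orbits \<phi> \<Longrightarrow> \<phi> s x \<in> null_orbits \<phi>"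
proof -
  assume s: "0 \<le> s" and x: "x \<in> null_orbits \<phi>"
  have "((\<lambda>t. \<phi> s (\<phi> t x)) \<longlongrightarrow> 0) at_top"
    using phi_tendsto[OF s null_tendsto[OF x]] by (simp add: phi_zero s)
  moreover have "\<forall>\<^sub>F t in at_top. \<phi> s (\<phi> t x) = \<phi> t (\<phi> s x)"
    using eventually_ge_at_top[of 0] by eventually_elim (simp add: phi_phi s add.commute)
  ultimately show ?thesis
    unfolding null_orbits_def by (simp cong: tendsto_cong)
qed

definition coord :: "'a \<Rightarrow> 'k" where
  "coord z = (THE k. z - sm k y \<in> null_orbits \<phi>)"

definition null_part :: "'a \<Rightarrow> 'a" where
  "null_part z = z - sm (coord z) y"

lemma scale_y_null_iff: "sm c y \<in> null_orbits \<phi> \<longleftrightarrow> c = 0"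
proof
  assume "sm c y \<in> null_orbits \<phi>"
  then have "sm (inverse c) (sm c y) \<in> null_orbits \<phi>"
    by (rule subspace_scale[OF subspace_null])
  then show "c = 0" using y_not_null by (cases "c = 0") auto
qed (simp add: subspace_0[OF subspace_null])

lemma y_nonzero: "y \<noteq> 0"
  using y_not_null subspace_0[OF subspace_null] by auto

lemma coord_eqI:
  assumes "z - sm k y \<in> null_orbits \<phi>"
  shows "coord z = k"
  unfolding coord_def
proof (rule the_equality, rule assms)
  fix l assume "z - sm l y \<in> null_orbits \<phi>"
  from subspace_diff[OF subspace_null assms this] have "sm (l - k) y \<in> null_orbits \<phi>"
    by (simp add: scale_left_diff_distrib)
  then show "l = k" by (simp add: scale_y_null_iff)
qed

lemma null_part_null: "null_part z \<in> null_orbits \<phi>"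
  unfolding null_part_def using decomposition[of z] coord_eqI by metis

lemma decompose: "z = null_part z + sm (coord z) y"
  by (simp add: null_part_def)

lemma coord_scale: "coord (sm c z) = c * coord z"
  using subspace_scale[OF subspace_null null_part_null, of c z]
  by (intro coord_eqI) (simp add: null_part_def scale_right_diff_distrib)

lemma coord_diff: "coord (a - b) = coord a - coord b"
  using subspace_diff[OF subspace_null null_part_null null_part_null, of a b]
  by (intro coord_eqI) (simp add: null_part_def scale_left_diff_distrib algebra_simps)

lemma null_part_scaleR: "null_part (r *\<^sub>R z) = r *\<^sub>R null_part z"
  by (simp add: null_part_def coord_scale scale_right_diff_distrib flip: sm_of_real)

lemma null_orbit_bdd:
  assumes x: "x \<in> null_orbits \<phi>"
  shows "bdd_above ((\<lambda>t. norm (\<phi> t x)) ` {1..})"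
proof -
  have "\<forall>\<^sub>F t in at_top. norm (\<phi> t x) < 1"
    using order_tendstoD(2)[OF tendsto_norm[OF null_tendsto[OF x]], of 1] by simp
  then obtain N where N: "\<And>t. N \<le> t \<Longrightarrow> norm (\<phi> t x) < 1"
    unfolding eventually_at_top_linorder by blast
  have "compact ((\<lambda>t. norm (\<phi> t x)) ` {1..N})"
    by (intro compact_continuous_image continuous_on_norm
        continuous_on_subset[OF orbit_continuous]) auto
  then have "bdd_above ((\<lambda>t. norm (\<phi> t x)) ` {1..N})"
    by (intro bounded_imp_bdd_above compact_imp_bounded)
  moreover have "bdd_above ((\<lambda>t. norm (\<phi> t x)) ` {N..})"
    using N by (intro bdd_aboveI[of _ 1]) (auto intro: less_imp_le)
  ultimately have "bdd_above ((\<lambda>t. norm (\<phi> t x)) ` {1..N} \<union> (\<lambda>t. norm (\<phi> t x)) ` {N..})"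
    by simp
  then show ?thesis
    unfolding image_Un[symmetric] by (rule bdd_above_mono) (intro image_mono, auto)
qed

text \<open>
  The supremum starts at time \<open>1\<close> since orbits are only known to be continuous at positive times.
\<close>

definition orbit_norm :: "'a \<Rightarrow> real" where
  "orbit_norm z = (SUP t\<in>{1..}. norm (\<phi> t (null_part z)))"

lemma orbit_norm_upper: "1 \<le> t \<Longrightarrow> norm (\<phi> t (null_part z)) \<le> orbit_norm z"
  unfolding orbit_norm_def by (rule cSUP_upper[OF _ null_orbit_bdd[OF null_part_null]]) simp

lemma orbit_norm_nonneg: "0 \<le> orbit_norm z"
  using orbit_norm_upper[of 1 z] norm_ge_zero[of "\<phi> 1 (null_part z)"] by linarith

lemma orbit_norm_scaleR: "orbit_norm (r *\<^sub>R z) = \<bar>r\<bar> * orbit_norm z"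
proof -
  have eq: "norm (\<phi> t (null_part (r *\<^sub>R z))) = \<bar>r\<bar> * norm (\<phi> t (null_part z))"
    if "0 \<le> t" for r z t
    using that by (simp only: null_part_scaleR) (simp add: phi_scale norm_sm flip: sm_of_real)
  have le: "orbit_norm (r *\<^sub>R z) \<le> \<bar>r\<bar> * orbit_norm z" for r z
    unfolding orbit_norm_def[of "r *\<^sub>R z"]
    by (rule cSUP_least) (auto simp: eq intro!: mult_left_mono orbit_norm_upper)
  show ?thesis
  proof (cases "r = 0")
    case True
    then show ?thesis using le[of 0 z] orbit_norm_nonneg[of "0 *\<^sub>R z"] by simp
  next
    case False
    have "\<bar>r\<bar> * orbit_norm (inverse r *\<^sub>R (r *\<^sub>R z)) \<le> \<bar>r\<bar> * (\<bar>inverse r\<bar> * orbit_norm (r *\<^sub>R z))"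
      by (rule mult_left_mono[OF le]) simp
    with False le[of r z] show ?thesis
      by (simp add: abs_inverse field_simps)
  qed
qed

lemma phi_norm_suminf:
  assumes x: "x sums l" and t: "1 \<le> t"
    and bound: "\<And>n. norm (\<phi> t (x n)) \<le> q n" and q: "summable q"
  shows "summable (\<lambda>n. norm (\<phi> t (x n)))" "norm (\<phi> t l) \<le> (\<Sum>n. norm (\<phi> t (x n)))"
proof -
  show s: "summable (\<lambda>n. norm (\<phi> t (x n)))"
    by (rule summable_comparison_test'[OF q, of 0]) (use bound in auto)
  have "(\<lambda>n. \<phi> t (x n)) sums \<phi> t l"
    using phi_tendsto[of t, OF _ x[unfolded sums_def]] t by (simp add: sums_def phi_sum)
  then show "norm (\<phi> t l) \<le> (\<Sum>n. norm (\<phi> t (x n)))"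
    using summable_norm[OF s] by (simp add: sums_iff)
qed

text \<open>
  The dominating series allows the limit in time to be taken term by term.
\<close>

lemma null_sums:
  assumes x: "x sums l" and null: "\<And>n. x n \<in> null_orbits \<phi>"
    and bound: "\<And>n t. 1 \<le> t \<Longrightarrow> norm (\<phi> t (x n)) \<le> q n" and q: "summable q"
  shows "l \<in> null_orbits \<phi>"
proof -
  have "\<forall>\<^sub>F (n, t) in at_top \<times>\<^sub>F at_top. norm (norm (\<phi> t (x n))) \<le> q n"
    unfolding eventually_prod_filter
    by (rule exI[of _ "\<lambda>_. True"], rule exI[of _ "\<lambda>t. 1 \<le> t"])
       (auto simp: bound eventually_ge_at_top)
  moreover have "((\<lambda>t. norm (\<phi> t (x n))) \<longlongrightarrow> 0) at_top" for n
    using tendsto_norm_zero[OF null_tendsto[OF null]] .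
  ultimately have "((\<lambda>t. \<Sum>n. norm (\<phi> t (x n))) \<longlongrightarrow> (\<Sum>n. 0)) at_top"
    using tannerys_theorem[of "\<lambda>n t. norm (\<phi> t (x n))" "\<lambda>_. 0" at_top q] q by simp
  moreover have "\<forall>\<^sub>F t in at_top. norm (\<phi> t l) \<le> (\<Sum>n. norm (\<phi> t (x n)))"
    using eventually_ge_at_top[of 1]
    by eventually_elim (rule phi_norm_suminf(2)[OF x _ bound q])
  ultimately show ?thesis
    unfolding null_orbits_def by (auto intro: Lim_null_comparison)
qed

text \<open>
  The null orbits form a Banach space under \<open>norm x + (SUP t\<in>{1..}. norm (\<phi> t x))\<close>, even though they
  are not known to be closed in the original norm. In terms of the projection along \<open>y\<close>, this
  completeness says that \<open>norm (null_part z) + orbit_norm z\<close> is a countably subadditive seminorm, hence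
  bounded by the original norm. This yields at once that the projection is continuous, so that the
  hyperplane is closed, and that the operators at times at least \<open>1\<close> are equibounded on it.
\<close>

lemma null_part_bounds:
  "\<exists>C>0. \<forall>z. norm (null_part z) \<le> C * norm z \<and>
     (\<forall>t\<ge>1. norm (\<phi> t (null_part z)) \<le> C * norm z)"
proof -
  define p where "p z = norm (null_part z) + orbit_norm z" for z
  have parts: "norm (null_part z) \<le> p z" "orbit_norm z \<le> p z" "0 \<le> p z" for z
    using orbit_norm_nonneg[of z] by (auto simp: p_def)
  have p_subadd: "p (suminf z) \<le> (\<Sum>n. p (z n))" if z: "summable z" and pz: "summable (\<lambda>n. p (z n))" for z
  proof -
    let ?x = "\<lambda>n. null_part (z n)"
    have q: "summable (\<lambda>n. orbit_norm (z n))"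
      by (rule summable_comparison_test'[OF pz, of 0]) (simp add: orbit_norm_nonneg parts)
    have nx: "summable (\<lambda>n. norm (?x n))"
      by (rule summable_comparison_test'[OF pz, of 0]) (simp add: parts)
    define l where "l = suminf ?x"
    have x: "?x sums l"
      unfolding l_def using summable_norm_cancel[OF nx] by (rule summable_sums)
    have "l \<in> null_orbits \<phi>"
      by (rule null_sums[OF x null_part_null orbit_norm_upper q])
    have "(\<lambda>n. z n - ?x n) sums (suminf z - l)"
      by (rule sums_diff[OF summable_sums[OF z] x])
    \<comment> \<open>Without continuity of \<open>coord\<close>, summability of the coordinates has to come from that of the vectors.\<close>
    then have "(\<lambda>n. sm (\<Sum>i<n. coord (z i)) y) \<longlonglongrightarrow> suminf z - l"
      unfolding sums_def null_part_def by (simp add: scale_sum_left)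
    then obtain c where c: "suminf z - l = sm c y"
      by (rule line_limit[OF y_nonzero])
    then have "coord (suminf z) = c"
      using \<open>l \<in> null_orbits \<phi>\<close> by (intro coord_eqI) (simp add: algebra_simps flip: c)
    then have l: "null_part (suminf z) = l"
      by (simp add: null_part_def algebra_simps flip: c)
    have "orbit_norm (suminf z) \<le> (\<Sum>n. orbit_norm (z n))"
      unfolding orbit_norm_def[of "suminf z"] l
    proof (rule cSUP_least)
      fix t :: real assume "t \<in> {1..}"
      then have t: "1 \<le> t" by simp
      note s = phi_norm_suminf[OF x t orbit_norm_upper[OF t] q]
      show "norm (\<phi> t l) \<le> (\<Sum>n. orbit_norm (z n))"
        using s(2) suminf_le[OF orbit_norm_upper[OF t] s(1) q] by linarith
    qed auto
    moreover have "norm (null_part (suminf z)) \<le> (\<Sum>n. norm (?x n))"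
      using summable_norm[OF nx] by (simp add: l l_def)
    ultimately show ?thesis
      unfolding p_def using suminf_add[OF nx q] by simp
  qed
  have p_scaleR: "p (r *\<^sub>R z) = \<bar>r\<bar> * p z" for r z
    by (simp add: p_def null_part_scaleR orbit_norm_scaleR distrib_left)
  obtain C where C: "0 < C" "\<And>z. p z \<le> C * norm z"
    using countably_subadditive_seminorm_bounded[OF parts(3) p_scaleR p_subadd] by blast
  have "norm (null_part z) \<le> C * norm z" for z
    using parts(1)[of z] C(2)[of z] by linarith
  moreover have "norm (\<phi> t (null_part z)) \<le> C * norm z" if "1 \<le> t" for z t
    using orbit_norm_upper[OF that, of z] parts(2)[of z] C(2)[of z] by linarith
  ultimately show ?thesis
    using C(1) by blast
qed

section \<open>The orbit of the complementary line\<close>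

lemma orbit_decompose:
  assumes "0 \<le> t" "0 \<le> s"
  shows "\<phi> (t + s) y = \<phi> t (null_part (\<phi> s y)) + sm (coord (\<phi> s y)) (\<phi> t y)"
proof -
  have "\<phi> t (\<phi> s y) = \<phi> t (null_part (\<phi> s y) + sm (coord (\<phi> s y)) y)"
    by (subst decompose) rule
  then show ?thesis
    using assms by (simp only: phi_phi phi_add phi_scale)
qed

text \<open>
  \<open>y\<close> spans the quotient by the hyperplane, which is invariant, so the semigroup acts
  on the quotient by scalars.
\<close>

lemma coord_orbit_add:
  assumes "0 \<le> t" "0 \<le> s"
  shows "coord (\<phi> (t + s) y) = coord (\<phi> s y) * coord (\<phi> t y)"
proof (rule coord_eqI)
  have "\<phi> (t + s) y - sm (coord (\<phi> s y) * coord (\<phi> t y)) y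
      = \<phi> t (null_part (\<phi> s y)) + sm (coord (\<phi> s y)) (null_part (\<phi> t y))"
    by (simp add: orbit_decompose[OF assms] null_part_def[of "\<phi> t y"] scale_right_diff_distrib)
  also have "\<dots> \<in> null_orbits \<phi>"
    by (intro subspace_add[OF subspace_null] subspace_scale[OF subspace_null]
        null_invariant assms null_part_null)
  finally show "\<phi> (t + s) y - sm (coord (\<phi> s y) * coord (\<phi> t y)) y \<in> null_orbits \<phi>" .
qed

lemma orbit_not_null:
  assumes s: "0 \<le> s"
  shows "\<phi> s y \<notin> null_orbits \<phi>"
proof
  assume "\<phi> s y \<in> null_orbits \<phi>"
  then have "((\<lambda>t. \<phi> t (\<phi> s y)) \<longlongrightarrow> 0) at_top"
    by (rule null_tendsto)
  moreover have "\<forall>\<^sub>F t in at_top. \<phi> t (\<phi> s y) = \<phi> (t + s) y"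
    using eventually_ge_at_top[of 0] by eventually_elim (simp add: phi_phi s)
  ultimately have "((\<lambda>t. \<phi> (t + s) y) \<longlongrightarrow> 0) at_top"
    by (rule Lim_transform_eventually)
  then have "((\<lambda>t. \<phi> (t - s + s) y) \<longlongrightarrow> 0) at_top"
    by (rule filterlim_compose)
       (rule filterlim_tendsto_add_at_top[of "\<lambda>_. - s" "- s" at_top "\<lambda>t. t", simplified],
        rule filterlim_ident)
  then show False
    using y_not_null by (simp add: null_orbits_def)
qed

lemma coord_orbit_nonzero: "0 \<le> s \<Longrightarrow> coord (\<phi> s y) \<noteq> 0"
  using orbit_not_null[of s] null_part_null[of "\<phi> s y"] by (auto simp: null_part_def)

text \<open>
  If the factor were less than \<open>1\<close> for some \<open>s\<close>, then passing from time \<open>T\<close> to \<open>T + s\<close> would contract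
  the orbit of \<open>y\<close> up to the error \<open>\<phi> T (null_part (\<phi> s y))\<close>, which tends to \<open>0\<close>. The orbit of \<open>y\<close> itself
  would tend to \<open>0\<close>, so \<open>y\<close> would lie in the hyperplane.
\<close>

lemma coord_orbit_ge_1:
  assumes s: "0 \<le> s"
  shows "1 \<le> norm (coord (\<phi> s y))"
proof (cases "s = 0")
  case True
  have "coord (\<phi> 0 y) = coord (\<phi> 0 y) * coord (\<phi> 0 y)"
    using coord_orbit_add[of 0 0] by simp
  then show ?thesis
    using coord_orbit_nonzero[of 0] True by simp
next
  case False
  show ?thesis
  proof (rule ccontr)
    assume less: "\<not> ?thesis"
    have "((\<lambda>T. norm (\<phi> T y)) \<longlongrightarrow> 0) at_top"
    proof (rule contraction_tendsto_zero)
      show "continuous_on {0<..} (\<lambda>T. norm (\<phi> T y))"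
        by (intro continuous_on_norm orbit_continuous)
      show "((\<lambda>T. norm (\<phi> T (null_part (\<phi> s y)))) \<longlongrightarrow> 0) at_top"
        by (intro tendsto_norm_zero null_tendsto null_part_null)
      show "norm (\<phi> (T + s) y)
          \<le> norm (\<phi> T (null_part (\<phi> s y))) + norm (coord (\<phi> s y)) * norm (\<phi> T y)"
        if "0 \<le> T" for T
        using norm_triangle_ineq[of "\<phi> T (null_part (\<phi> s y))"]
        by (simp add: orbit_decompose[OF that s] norm_sm flip: norm_sm)
    qed (use less s False in auto)
    then have "((\<lambda>T. \<phi> T y) \<longlongrightarrow> 0) at_top"
      by (rule tendsto_norm_zero_cancel)
    then show False
      using y_not_null by (simp add: null_orbits_def)
  qed
qed

lemma coord_bound:
  "\<exists>M>0. \<forall>z. norm (coord z) \<le> M * norm z"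
proof -
  have y0: "0 < norm y" using y_nonzero by simp
  obtain C where C: "0 < C" "\<And>z. norm (null_part z) \<le> C * norm z"
    using null_part_bounds by blast
  show ?thesis
  proof (intro exI conjI allI)
    show "0 < (1 + C) / norm y" using y0 C(1) by simp
    fix z
    have "norm (coord z) * norm y = norm (z - null_part z)"
      by (simp add: null_part_def norm_sm)
    also have "\<dots> \<le> (1 + C) * norm z"
      using norm_triangle_ineq4[of z "null_part z"] C(2)[of z] by (simp add: distrib_right)
    finally show "norm (coord z) \<le> (1 + C) / norm y * norm z"
      using y0 by (simp add: field_simps)
  qed
qed

lemma coord_tendsto:
  assumes "(f \<longlongrightarrow> l) F"
  shows "((\<lambda>x. coord (f x)) \<longlongrightarrow> coord l) F"
proof -
  obtain M where M: "0 < M" "\<And>z. norm (coord z) \<le> M * norm z"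
    using coord_bound by blast
  have "((\<lambda>x. M * norm (f x - l)) \<longlongrightarrow> 0) F"
    using tendsto_mult_left[OF tendsto_norm_zero[OF LIM_zero[OF assms]], of M] by simp
  then have "((\<lambda>x. coord (f x) - coord l) \<longlongrightarrow> 0) F"
    by (rule Lim_null_comparison[rotated]) (simp add: M(2) flip: coord_diff)
  then show ?thesis
    by (rule LIM_zero_cancel)
qed

text \<open>
  Nothing is known about \<open>\<phi> s y\<close> as \<open>s\<close> tends to \<open>0\<close>. Applying \<open>\<phi> 1\<close> moves the orbit away from time
  \<open>0\<close>, and multiplicativity expresses the coordinate at time \<open>s\<close> through the one at time \<open>1 + s\<close>.
\<close>

lemma continuous_shifted_null_part:
  "continuous_on {0..t} (\<lambda>s. \<phi> 1 (null_part (\<phi> s y)))"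
proof -
  have orbit: "continuous_on {0..t} (\<lambda>s. \<phi> (1 + s) y)"
    by (rule continuous_on_compose2[OF orbit_continuous]) (auto intro!: continuous_intros)
  have "continuous_on {0..t} (\<lambda>s. sm (coord (\<phi> s y)) (\<phi> 1 y))"
    unfolding continuous_on_def
  proof
    fix s assume s: "s \<in> {0..t}"
    let ?F = "at s within {0..t}"
    have "((\<lambda>r. \<phi> (1 + r) y) \<longlongrightarrow> \<phi> (1 + s) y) ?F"
      using orbit s by (simp add: continuous_on_def)
    then have "((\<lambda>r. coord (\<phi> (1 + r) y)) \<longlongrightarrow> coord (\<phi> (1 + s) y)) ?F"
      by (rule coord_tendsto)
    then have "((\<lambda>r. coord (\<phi> (1 + r) y) / coord (\<phi> 1 y))
        \<longlongrightarrow> coord (\<phi> (1 + s) y) / coord (\<phi> 1 y)) ?F"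
      by (intro tendsto_divide tendsto_const coord_orbit_nonzero) simp_all
    moreover have "coord (\<phi> (1 + r) y) / coord (\<phi> 1 y) = coord (\<phi> r y)" if "0 \<le> r" for r
      using that by (simp add: coord_orbit_add coord_orbit_nonzero)
    ultimately have "((\<lambda>r. coord (\<phi> r y)) \<longlongrightarrow> coord (\<phi> s y)) ?F"
      using s by (auto simp: Lim_within)
    then show "((\<lambda>r. sm (coord (\<phi> r y)) (\<phi> 1 y)) \<longlongrightarrow> sm (coord (\<phi> s y)) (\<phi> 1 y)) ?F"
      by (rule tendsto_scale_left)
  qed
  then have "continuous_on {0..t} (\<lambda>s. \<phi> (1 + s) y - sm (coord (\<phi> s y)) (\<phi> 1 y))"
    by (rule continuous_on_diff[OF orbit])
  then show ?thesis
    by (rule continuous_on_eq) (simp add: orbit_decompose)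
qed

text \<open>
  Pointwise convergence on a finite net suffices, because the operators are equibounded on the
  hyperplane.
\<close>

lemma null_uniform_on_compact:
  assumes K: "compact K" "K \<subseteq> null_orbits \<phi>" and e: "0 < e"
  shows "\<forall>\<^sub>F t in at_top. \<forall>x\<in>K. norm (\<phi> t x) < e"
proof -
  obtain C where C: "0 < C" "\<And>z t. 1 \<le> t \<Longrightarrow> norm (\<phi> t (null_part z)) \<le> C * norm z"
    using null_part_bounds by blast
  have bound: "norm (\<phi> t x) \<le> C * norm x" if "1 \<le> t" "x \<in> null_orbits \<phi>" for t x
    using C(2)[OF that(1), of x] coord_eqI[of x 0] that(2) by (simp add: null_part_def)
  have "0 < e / (2 * C)" using e C(1) by simp
  then have "\<exists>F. finite F \<and> F \<subseteq> K \<and> K \<subseteq> (\<Union>x\<in>F. ball x (e / (2 * C)))"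
    using seq_compact_imp_totally_bounded[OF compact_imp_seq_compact[OF K(1)]] by simp
  then obtain F where F: "finite F" "F \<subseteq> K" "K \<subseteq> (\<Union>x\<in>F. ball x (e / (2 * C)))"
    by (elim exE conjE)
  have "\<forall>\<^sub>F t in at_top. norm (\<phi> t x) < e / 2" if "x \<in> F" for x
    using order_tendstoD(2)[OF tendsto_norm_zero[OF null_tendsto], of x "e / 2"] that F(2) K(2) e
    by auto
  then have "\<forall>\<^sub>F t in at_top. \<forall>x\<in>F. norm (\<phi> t x) < e / 2"
    using F(1) by (simp add: eventually_ball_finite)
  then show ?thesis
    using eventually_ge_at_top[of 1]
  proof eventually_elim
    case (elim t)
    show ?case
    proof
      fix x assume x: "x \<in> K"
      then obtain a where a: "a \<in> F" "dist a x < e / (2 * C)"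
        using F(3) by auto
      have "x - a \<in> null_orbits \<phi>"
        using x a F(2) K(2) by (intro subspace_diff[OF subspace_null]) auto
      then have "norm (\<phi> t (x - a)) \<le> C * norm (x - a)"
        by (rule bound[OF elim(2)])
      also have "\<dots> < e / 2"
        using a(2) C(1) by (simp add: dist_norm norm_minus_commute field_simps)
      finally have "norm (\<phi> t x - \<phi> t a) < e / 2"
        using elim(2) by (simp add: phi_diff)
      then show "norm (\<phi> t x) < e"
        using elim(1) a(1) norm_triangle_sub[of "\<phi> t x" "\<phi> t a"] by fastforce
    qed
  qed
qed

lemma orbit_drift_uniform:
  assumes e: "0 < e"
  shows "\<forall>\<^sub>F T in at_top. \<forall>s\<in>{0..t}. norm (\<phi> T (null_part (\<phi> s y))) < e"
proof -
  let ?h = "\<lambda>s. \<phi> 1 (null_part (\<phi> s y))"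
  have "compact (?h ` {0..t})"
    by (intro compact_continuous_image continuous_shifted_null_part) simp
  moreover have "?h ` {0..t} \<subseteq> null_orbits \<phi>"
    by (auto intro!: null_invariant null_part_null)
  ultimately have "\<forall>\<^sub>F T in at_top. \<forall>x\<in>?h ` {0..t}. norm (\<phi> T x) < e"
    using e by (rule null_uniform_on_compact)
  then obtain T0 where T0: "\<And>T s. T0 \<le> T \<Longrightarrow> s \<in> {0..t} \<Longrightarrow> norm (\<phi> T (?h s)) < e"
    unfolding eventually_at_top_linorder by blast
  have "norm (\<phi> T (null_part (\<phi> s y))) < e" if "max (T0 + 1) 1 \<le> T" "s \<in> {0..t}" for T s
    using T0[of "T - 1" s] that phi_phi[of "T - 1" 1] by simp
  then show ?thesis
    unfolding eventually_at_top_linorder by blast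
qed

lemma line_image:
  assumes "0 \<le> t"
  shows "\<phi> t ` range (\<lambda>c. sm c y) = range (\<lambda>c. sm c (\<phi> t y))"
  using assms by (simp add: image_image phi_scale)

text \<open>
  By \<open>orbit_decompose\<close>, the generators of the lines at times \<open>T\<close> and \<open>T + s\<close> differ, up to a scalar of
  modulus at least \<open>1\<close>, by the drift \<open>\<phi> T (null_part (\<phi> s y))\<close>. The coordinate of \<open>\<phi> T y\<close> has modulus
  at least \<open>1\<close> and \<open>coord\<close> is bounded, so \<open>\<phi> T y\<close> stays away from \<open>0\<close>.
\<close>

theorem line_almost_stabilizable: "almost_stabilizable \<phi> (range (\<lambda>c. sm c y))"
  unfolding almost_stabilizable_def
proof (intro allI impI)
  fix t :: real assume t: "0 < t"
  obtain M where M: "0 < M" "\<And>z. norm (coord z) \<le> M * norm z"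
    using coord_bound by blast
  let ?angle = "\<lambda>T s. subspace_angle (\<phi> T ` range (\<lambda>c. sm c y)) (\<phi> (T + s) ` range (\<lambda>c. sm c y))"
  have lower: "1 / M \<le> norm (\<phi> T y)" if "0 \<le> T" for T
    using coord_orbit_ge_1[OF that] M(2)[of "\<phi> T y"] M(1) by (simp add: field_simps)
  then have nonzero: "\<phi> T y \<noteq> 0" if "0 \<le> T" for T
    using that M(1) by fastforce
  have nonneg: "0 \<le> ?angle T s" if "0 \<le> T" "0 \<le> s" for T s
    using that by (simp only: line_image add_nonneg_nonneg) (intro angle_lines_nonneg nonzero; simp)
  have le: "?angle T s \<le> M * norm (\<phi> T (null_part (\<phi> s y)))" if T: "0 \<le> T" and s: "0 \<le> s" for T s
  proof -
    have "?angle T s \<le> norm (\<phi> T (null_part (\<phi> s y))) / norm (\<phi> T y)"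
      unfolding line_image[OF T] line_image[OF add_nonneg_nonneg[OF T s]]
      by (rule angle_lines_le[OF nonzero[OF T] orbit_decompose[OF T s] coord_orbit_ge_1[OF s]])
    also have "\<dots> \<le> norm (\<phi> T (null_part (\<phi> s y))) / (1 / M)"
      using lower[OF T] M(1) nonzero[OF T] by (intro divide_left_mono) auto
    finally show ?thesis by (simp add: mult.commute)
  qed
  show "((\<lambda>T. SUP s\<in>{0..<t}. ?angle T s) \<longlongrightarrow> 0) at_top"
  proof (rule tendstoI)
    fix e :: real assume e: "0 < e"
    have "\<forall>\<^sub>F T in at_top. \<forall>s\<in>{0..t}. norm (\<phi> T (null_part (\<phi> s y))) < e / (2 * M)"
      using e M(1) by (intro orbit_drift_uniform) simp
    then show "\<forall>\<^sub>F T in at_top. dist (SUP s\<in>{0..<t}. ?angle T s) 0 < e"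
      using eventually_ge_at_top[of 0]
    proof eventually_elim
      case (elim T)
      have small: "?angle T s \<le> e / 2" if "s \<in> {0..<t}" for s
      proof -
        have "norm (\<phi> T (null_part (\<phi> s y))) \<le> e / (2 * M)"
          using elim(1) that by (auto intro: less_imp_le)
        then have "M * norm (\<phi> T (null_part (\<phi> s y))) \<le> e / 2"
          using M(1) by (simp add: field_simps)
        with le[OF elim(2), of s] that show ?thesis by simp
      qed
      have "(SUP s\<in>{0..<t}. ?angle T s) \<le> e / 2"
        using t small by (intro cSUP_least) auto
      moreover have "0 \<le> (SUP s\<in>{0..<t}. ?angle T s)"
        using t small nonneg[OF elim(2), of 0]
        by (intro cSUP_upper2[of "?angle T" _ 0] bdd_aboveI[of _ "e / 2"]) auto
      ultimately show ?case using e by simp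
    qed
  qed
qed

end

theorem mainTheorem5:
  fixes sm :: "'k :: {real_normed_field, heine_borel} \<Rightarrow> 'a :: banach \<Rightarrow> 'a"
    and \<phi> :: "real \<Rightarrow> 'a \<Rightarrow> 'a"
    and Y :: "'a set"
  assumes "banach_space_over sm"
    and "operator_semigroup sm \<phi>"
    and "\<And>v. continuous_on {0<..} (\<lambda>t. \<phi> t v)"
    and "has_codim sm (null_orbits \<phi>) 1"
    and "module.subspace sm Y"
    and "vector_space.dim sm Y = 1"
    and "direct_sum_UNIV (null_orbits \<phi>) Y"
  shows "almost_stabilizable \<phi> Y"
proof -
  interpret banach_space_over sm by fact
  obtain B where B: "B \<subseteq> Y" "independent B" "Y \<subseteq> span B" "card B = 1"
    using basis_exists[of Y] assms(6) by metis
  then obtain y where y: "B = {y}"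
    by (metis card_1_singletonE)
  have Y: "Y = range (\<lambda>c. sm c y)"
    using B span_minimal[OF B(1) assms(5)] by (simp add: y span_singleton)
  have y0: "y \<noteq> 0"
    using B(2) dependent_zero[of B] y by auto
  interpret null_hyperplane_semigroup sm \<phi> y
  proof
    show "operator_semigroup sm \<phi>" by fact
    show "continuous_on {0<..} (\<lambda>t. \<phi> t v)" for v by fact
    show "subspace (null_orbits \<phi>)"
      using assms(4) by (simp add: has_codim_def)
    show "y \<notin> null_orbits \<phi>"
      using assms(7) B(1) y y0 by (auto simp: direct_sum_UNIV_def)
    show "\<exists>k. z - sm k y \<in> null_orbits \<phi>" for z
    proof -
      obtain a b where ab: "a \<in> null_orbits \<phi>" "b \<in> Y" "z = a + b"
        using assms(7) unfolding direct_sum_UNIV_def by blast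
      from ab(2) obtain k where "b = sm k y" unfolding Y by blast
      with ab show ?thesis by (intro exI[of _ k]) simp
    qed
  qed
  show ?thesis
    unfolding Y by (rule line_almost_stabilizable)
qed

end
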